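(* Let $\mathcal{K}$ be a Hilbert space of finite dimension $q$. Let $(\mathbf{Q}^{(s)})_{s=1}^{\nu}$ be a $\nu$-tuple of distinct non-trivial constraints $\mathbf{Q}^{(s)}=\{Q_t^s:1\le t\le\tau_s\}$ on $\mathcal{K}$. For $1\le s\le\nu$, let $\mathcal{P}^{(s)}=\{\mathcal{P}_v^s:1\le v\le g_s\}$, $g_s\ge2$, be a family of $\mathbf{Q}^{(s)}$-constrained elementary measurements $\mathcal{P}_v^s=\{P_{s,v,j}:0\le j\le q-1\}$. Then, for estimation purposes, the family $\Pi=\{P_{s,v,j}:1\le s\le\nu,\ 1\le v\le g_s,\ 0\le j\le q-1\}$ can be replaced by a smaller (sub)family $\Pi'\subseteq\Pi$ with $$\#\Pi'\le\Big(\sum_{s=1}^{\nu}g_s\Big)q-\sum_{s=1}^{\nu}(g_s-1)\tau_s-(\nu-1).$$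
   Context: A constraint on $\mathcal{K}$ is a family $\mathbf{Q}=\{Q_t:1\le t\le\tau\}$ of mutually orthogonal (nonzero) projections with $\sum_tQ_t=I_{\mathcal{K}}$ such that $\mathrm{rank}\,Q_t\ge2$ for some $t$. It is trivial if $\tau=1$ and non-trivial if $\tau>1$. A family $\mathcal{P}=\{P_j:0\le j\le q-1\}$ of mutually orthogonal rank one projections with $\sum_jP_j=I_{\mathcal{K}}$ is a $\mathbf{Q}$-constrained elementary measurement if $\{0,\dots,q-1\}$ is a disjoint union of sets $I_t$, $1\le t\le\tau$, with $\sum_{j\in I_t}P_j=Q_t$ for each $t$. "A family $\Pi$ of projections can be replaced, for estimation purposes, by $\Pi'\subseteq\Pi$" means that every member of $\Pi$ is a linear combination of members of $\Pi'$ (so that for each operator $\rho$ the numbers $\mathrm{tr}(\rho P)$, $P\in\Pi$, are determined by those with $P\in\Pi'$). *)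

theory Defs
  imports "HOL-Analysis.Analysis"
begin

text \<open>The distribution has no complex inner product spaces, so they are built on the
  library's \<^locale>\<open>vector_space\<close>. The inner product is linear in the first argument.
  Completeness is automatic in finite dimension and therefore not assumed.\<close>

locale fin_dim_hilbert = vector_space scale
  for scale :: "complex \<Rightarrow> 'a::ab_group_add \<Rightarrow> 'a" +
  fixes ip :: "'a \<Rightarrow> 'a \<Rightarrow> complex"
  assumes ip_add_left: "ip (x + y) z = ip x z + ip y z"
    and ip_scale_left: "ip (scale c x) y = c * ip x y"
    and ip_commute: "ip x y = cnj (ip y x)"
    and ip_pos: "x \<noteq> 0 \<Longrightarrow> Re (ip x x) > 0"
    and finite_spanning_set: "\<exists>B. finite B \<and> span B = UNIV"
begin

definition projection :: "('a \<Rightarrow> 'a) \<Rightarrow> bool" where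
  "projection P \<longleftrightarrow> Vector_Spaces.linear scale scale P
     \<and> (\<forall>x. P (P x) = P x) \<and> (\<forall>x y. ip (P x) y = ip x (P y))"

definition op_rank :: "('a \<Rightarrow> 'a) \<Rightarrow> nat" where
  "op_rank A = dim (range A)"

definition resolution_of_identity :: "'i set \<Rightarrow> ('i \<Rightarrow> 'a \<Rightarrow> 'a) \<Rightarrow> bool" where
  "resolution_of_identity I P \<longleftrightarrow> finite I
     \<and> (\<forall>i\<in>I. projection (P i))
     \<and> (\<forall>i\<in>I. \<forall>j\<in>I. i \<noteq> j \<longrightarrow> (\<forall>x. P i (P j x) = 0))
     \<and> (\<forall>x. (\<Sum>i\<in>I. P i x) = x)"

definition constraint :: "nat \<Rightarrow> (nat \<Rightarrow> 'a \<Rightarrow> 'a) \<Rightarrow> bool" where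
  "constraint \<tau> Q \<longleftrightarrow> resolution_of_identity {1..\<tau>} Q
     \<and> (\<forall>t\<in>{1..\<tau>}. Q t \<noteq> (\<lambda>x. 0))
     \<and> (\<exists>t\<in>{1..\<tau>}. op_rank (Q t) \<ge> 2)"

definition nontrivial_constraint :: "nat \<Rightarrow> (nat \<Rightarrow> 'a \<Rightarrow> 'a) \<Rightarrow> bool" where
  "nontrivial_constraint \<tau> Q \<longleftrightarrow> constraint \<tau> Q \<and> \<tau> > 1"

text \<open>Here \<^term>\<open>dim UNIV\<close> is the dimension \<open>q\<close> of the whole space.\<close>

definition elementary_measurement :: "(nat \<Rightarrow> 'a \<Rightarrow> 'a) \<Rightarrow> bool" where
  "elementary_measurement P \<longleftrightarrow> resolution_of_identity {0..<dim UNIV} P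
     \<and> (\<forall>j\<in>{0..<dim UNIV}. op_rank (P j) = 1)"

definition constrained_elementary_measurement ::
    "nat \<Rightarrow> (nat \<Rightarrow> 'a \<Rightarrow> 'a) \<Rightarrow> (nat \<Rightarrow> 'a \<Rightarrow> 'a) \<Rightarrow> bool" where
  "constrained_elementary_measurement \<tau> Q P \<longleftrightarrow> elementary_measurement P
     \<and> (\<exists>I. disjoint_family_on I {1..\<tau>} \<and> (\<Union>t\<in>{1..\<tau>}. I t) = {0..<dim UNIV}
          \<and> (\<forall>t\<in>{1..\<tau>}. \<forall>x. (\<Sum>j\<in>I t. P j x) = Q t x))"

text \<open>The family \<open>(P i)\<close>, \<open>i \<in> I\<close>, can be replaced, for estimation purposes, by its
  subfamily indexed by the finite set \<open>J\<close>. Families are kept indexed, so that members which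
  happen to coincide as operators are counted separately.\<close>

definition replaceable_by :: "('i \<Rightarrow> 'a \<Rightarrow> 'a) \<Rightarrow> 'i set \<Rightarrow> 'i set \<Rightarrow> bool" where
  "replaceable_by P I J \<longleftrightarrow> finite J \<and> J \<subseteq> I
     \<and> (\<forall>i\<in>I. \<exists>c :: 'i \<Rightarrow> complex. \<forall>x. P i x = (\<Sum>j\<in>J. scale (c j) (P j x)))"

end

text \<open>The standard model, showing that the axioms are satisfiable in every dimension
  \<open>q \<ge> 1\<close>.\<close>

lemma fin_dim_hilbert_vec:
  "fin_dim_hilbert ((*s) :: complex \<Rightarrow> complex ^ 'n \<Rightarrow> _) (\<lambda>x y. \<Sum>i\<in>UNIV. x $ i * cnj (y $ i))"
proof unfold_locales
  fix x y z :: "complex ^ 'n" and c :: complex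
  show "(\<Sum>i\<in>UNIV. (x + y) $ i * cnj (z $ i)) =
      (\<Sum>i\<in>UNIV. x $ i * cnj (z $ i)) + (\<Sum>i\<in>UNIV. y $ i * cnj (z $ i))"
    by (simp add: distrib_right sum.distrib)
  show "(\<Sum>i\<in>UNIV. (c *s x) $ i * cnj (y $ i)) = c * (\<Sum>i\<in>UNIV. x $ i * cnj (y $ i))"
    by (simp add: sum_distrib_left mult.assoc)
  show "(\<Sum>i\<in>UNIV. x $ i * cnj (y $ i)) = cnj (\<Sum>i\<in>UNIV. y $ i * cnj (x $ i))"
    by (simp add: mult.commute)
  show "Re (\<Sum>i\<in>UNIV. x $ i * cnj (x $ i)) > 0" if "x \<noteq> 0"
  proof -
    from that obtain k where k: "x $ k \<noteq> 0" by (auto simp: vec_eq_iff)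
    have "(\<Sum>i\<in>UNIV. (cmod (x $ i))\<^sup>2) > 0"
      by (rule sum_pos2[where i = k]) (use k in auto)
    then show ?thesis
      by (simp flip: complex_norm_square of_real_power)
  qed
  show "\<exists>B :: (complex ^ 'n) set. finite B \<and> vec.span B = UNIV"
    using vec.finite_Basis vec.span_Basis by blast
qed

end

theory Submission
  imports Defs
begin

text \<open>The relations among the projections are \<open>\<Sum>j\<in>I\<^sub>t. P\<^bsub>s,v,j\<^esub> = Q\<^sub>t = \<Sum>j\<in>I'\<^sub>t. P\<^bsub>s,1,j\<^esub>\<close> for
  \<open>v \<ge> 2\<close>, and \<open>\<Sum>j. P\<^bsub>s,1,j\<^esub> = I = \<Sum>j. P\<^bsub>1,1,j\<^esub>\<close> for \<open>s \<ge> 2\<close>. Each relation of the first kind makes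
  one projection of every block \<open>I\<^sub>t\<close> superfluous when \<open>v \<ge> 2\<close>, which saves \<open>(g\<^sub>s - 1) \<tau>\<^sub>s\<close>
  projections for each \<open>s\<close>; the second kind saves one projection of every first measurement with
  \<open>s \<ge> 2\<close>, that is, \<open>\<nu> - 1\<close> more.\<close>

context fin_dim_hilbert
begin

definition lin_comb :: "('i \<Rightarrow> 'a \<Rightarrow> 'a) \<Rightarrow> 'i set \<Rightarrow> ('a \<Rightarrow> 'a) \<Rightarrow> bool" where
  "lin_comb F J A \<longleftrightarrow> (\<exists>c. \<forall>x. A x = (\<Sum>j\<in>J. scale (c j) (F j x)))"

lemma lin_comb_member:
  assumes "finite J" "i \<in> J"
  shows "lin_comb F J (F i)"
proof -
  have "F i x = (\<Sum>j\<in>J. scale (if j = i then 1 else 0) (F j x))" for x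
  proof -
    have "(\<Sum>j\<in>J. scale (if j = i then 1 else 0) (F j x)) = (\<Sum>j\<in>J. if j = i then F j x else 0)"
      by (rule sum.cong) auto
    with assms show ?thesis by simp
  qed
  then show ?thesis unfolding lin_comb_def by (intro exI[of _ "\<lambda>j. if j = i then 1 else 0"]) blast
qed

lemma lin_comb_zero: "lin_comb F J (\<lambda>x. 0)"
  unfolding lin_comb_def by (rule exI[of _ "\<lambda>_. 0"]) simp

lemma lin_comb_add:
  assumes "lin_comb F J A" "lin_comb F J B"
  shows "lin_comb F J (\<lambda>x. A x + B x)"
proof -
  obtain a b where "\<And>x. A x = (\<Sum>j\<in>J. scale (a j) (F j x))"
    "\<And>x. B x = (\<Sum>j\<in>J. scale (b j) (F j x))"
    using assms unfolding lin_comb_def by blast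
  then show ?thesis unfolding lin_comb_def
    by (intro exI[of _ "\<lambda>j. a j + b j"]) (simp add: scale_left_distrib sum.distrib)
qed

lemma lin_comb_diff:
  assumes "lin_comb F J A" "lin_comb F J B"
  shows "lin_comb F J (\<lambda>x. A x - B x)"
proof -
  obtain a b where "\<And>x. A x = (\<Sum>j\<in>J. scale (a j) (F j x))"
    "\<And>x. B x = (\<Sum>j\<in>J. scale (b j) (F j x))"
    using assms unfolding lin_comb_def by blast
  then show ?thesis unfolding lin_comb_def
    by (intro exI[of _ "\<lambda>j. a j - b j"]) (simp add: scale_left_diff_distrib sum_subtractf)
qed

lemma lin_comb_sum:
  assumes "\<And>k. k \<in> K \<Longrightarrow> lin_comb F J (A k)"
  shows "lin_comb F J (\<lambda>x. \<Sum>k\<in>K. A k x)"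
  using assms
  by (induction K rule: infinite_finite_induct) (simp_all add: lin_comb_zero lin_comb_add)

lemma lin_comb_sum_remove:
  assumes "finite K" "k \<in> K" "lin_comb F J (\<lambda>x. \<Sum>i\<in>K. A i x)"
    and "\<And>i. i \<in> K - {k} \<Longrightarrow> lin_comb F J (A i)"
  shows "lin_comb F J (A k)"
proof -
  have "lin_comb F J (\<lambda>x. (\<Sum>i\<in>K. A i x) - (\<Sum>i\<in>K - {k}. A i x))"
    by (intro lin_comb_diff lin_comb_sum assms)
  moreover have "(\<lambda>x. (\<Sum>i\<in>K. A i x) - (\<Sum>i\<in>K - {k}. A i x)) = A k"
    using assms(1,2) by (simp add: sum.remove[where A = K and x = k])
  ultimately show ?thesis by simp
qed

end

theorem theorem3p1p4:
  fixes scale :: "complex \<Rightarrow> 'a::ab_group_add \<Rightarrow> 'a"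
    and ip :: "'a \<Rightarrow> 'a \<Rightarrow> complex"
    and q \<nu> :: nat
    and \<tau> g :: "nat \<Rightarrow> nat"
    and Q :: "nat \<Rightarrow> nat \<Rightarrow> 'a \<Rightarrow> 'a"
    and P :: "nat \<Rightarrow> nat \<Rightarrow> nat \<Rightarrow> 'a \<Rightarrow> 'a"
  defines "Idx \<equiv> {(s, v, j). s \<in> {1..\<nu>} \<and> v \<in> {1..g s} \<and> j \<in> {0..<q}}"
  assumes "fin_dim_hilbert scale ip"
    and "vector_space.dim scale (UNIV :: 'a set) = q"
    and "\<nu> \<ge> 1"
    and "\<And>s. s \<in> {1..\<nu>} \<Longrightarrow> fin_dim_hilbert.nontrivial_constraint scale ip (\<tau> s) (Q s)"
    and "inj_on (\<lambda>s. Q s ` {1..\<tau> s}) {1..\<nu>}"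
    and "\<And>s. s \<in> {1..\<nu>} \<Longrightarrow> g s \<ge> 2"
    and "\<And>s v. s \<in> {1..\<nu>} \<Longrightarrow> v \<in> {1..g s} \<Longrightarrow>
           fin_dim_hilbert.constrained_elementary_measurement scale ip (\<tau> s) (Q s) (P s v)"
  shows "\<exists>J. J \<subset> Idx
      \<and> fin_dim_hilbert.replaceable_by scale (\<lambda>(s, v, j). P s v j) Idx J
      \<and> int (card J) \<le> (\<Sum>s=1..\<nu>. int (g s)) * int q
            - (\<Sum>s=1..\<nu>. (int (g s) - 1) * int (\<tau> s)) - (int \<nu> - 1)"
proof -
  note hyps = assms(2-)
  interpret fin_dim_hilbert scale ip by fact
  have dimq: "dim UNIV = q" by fact
  have res: "resolution_of_identity {0..<q} (P s v)" if "s \<in> {1..\<nu>}" "v \<in> {1..g s}" for s v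
    using hyps(7)[OF that] dimq
    unfolding constrained_elementary_measurement_def elementary_measurement_def by simp
  have "\<forall>s v. \<exists>I. s \<in> {1..\<nu>} \<longrightarrow> v \<in> {1..g s} \<longrightarrow>
      disjoint_family_on I {1..\<tau> s} \<and> (\<Union>t\<in>{1..\<tau> s}. I t) = {0..<q}
      \<and> (\<forall>t\<in>{1..\<tau> s}. \<forall>x. (\<Sum>j\<in>I t. P s v j x) = Q s t x)"
    using hyps(7) dimq unfolding constrained_elementary_measurement_def by metis
  then obtain I where I: "\<And>s v. s \<in> {1..\<nu>} \<Longrightarrow> v \<in> {1..g s} \<Longrightarrow>
      disjoint_family_on (I s v) {1..\<tau> s} \<and> (\<Union>t\<in>{1..\<tau> s}. I s v t) = {0..<q}
      \<and> (\<forall>t\<in>{1..\<tau> s}. \<forall>x. (\<Sum>j\<in>I s v t. P s v j x) = Q s t x)"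
    by metis
  have \<tau>1: "\<tau> s > 1" and Q0: "\<And>t. t \<in> {1..\<tau> s} \<Longrightarrow> Q s t \<noteq> (\<lambda>x. 0)" if "s \<in> {1..\<nu>}" for s
    using hyps(4)[OF that] unfolding nontrivial_constraint_def constraint_def by auto
  have g2: "g s \<ge> 2" if "s \<in> {1..\<nu>}" for s using hyps(6) that .
  define e where "e s v t = (SOME j. j \<in> I s v t)" for s v t
  have e: "e s v t \<in> I s v t" if "s \<in> {1..\<nu>}" "v \<in> {1..g s}" "t \<in> {1..\<tau> s}" for s v t
  proof -
    have "I s v t \<noteq> {}"
    proof
      assume "I s v t = {}"
      moreover have "\<forall>x. (\<Sum>j\<in>I s v t. P s v j x) = Q s t x"
        using I[OF that(1,2)] that(3) by blast
      ultimately have "Q s t = (\<lambda>x. 0)" by (intro ext) simp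
      then show False using Q0[OF that(1,3)] by simp
    qed
    then show ?thesis unfolding e_def by (simp add: some_in_eq)
  qed
  have Iq: "I s v t \<subseteq> {0..<q}" if "s \<in> {1..\<nu>}" "v \<in> {1..g s}" "t \<in> {1..\<tau> s}" for s v t
    using I[OF that(1,2)] that(3) by blast
  have same_block: "t = t'"
    if "s \<in> {1..\<nu>}" "v \<in> {1..g s}" "t \<in> {1..\<tau> s}" "t' \<in> {1..\<tau> s}" "j \<in> I s v t" "j \<in> I s v t'"
    for s v t t' j
    using I[OF that(1,2)] that(3-) unfolding disjoint_family_on_def by blast
  have q0: "q > 0"
  proof -
    have "1 \<in> {1..\<nu>}" using hyps(3) by simp
    moreover from this have "1 \<in> {1..g 1}" "1 \<in> {1..\<tau> 1}" using g2[of 1] \<tau>1[of 1] by auto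
    ultimately show ?thesis using e[of 1 1 1] Iq[of 1 1 1] by force
  qed

  define S where "S = (SIGMA s:{1..\<nu>}. {2..g s} \<times> {1..\<tau> s})"
  define D1 where "D1 = (\<lambda>(s, v, t). (s, v, e s v t)) ` S"
  define D2 where "D2 = (\<lambda>s. (s, 1::nat, 0::nat)) ` {2..\<nu>}"
  define J where "J = Idx - (D1 \<union> D2)"
  have Idx_Sigma: "Idx = (SIGMA s:{1..\<nu>}. {1..g s} \<times> {0..<q})"
    unfolding Idx_def by auto
  have finIdx: "finite Idx" unfolding Idx_Sigma by auto
  have "inj_on (\<lambda>(s, v, t). (s, v, e s v t)) S"
  proof (rule inj_onI, clarsimp)
    fix s v t t'
    assume st: "(s, v, t) \<in> S" "(s, v, t') \<in> S" and eq: "e s v t = e s v t'"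
    then have "s \<in> {1..\<nu>}" "v \<in> {1..g s}" "t \<in> {1..\<tau> s}" "t' \<in> {1..\<tau> s}"
      by (auto simp: S_def)
    then show "t = t'" using same_block[of s v t t' "e s v t"] e[of s v t] e[of s v t'] eq by simp
  qed
  then have cardD1: "card D1 = (\<Sum>s=1..\<nu>. (g s - 1) * \<tau> s)"
    unfolding D1_def by (simp add: card_image S_def)
  have cardD2: "card D2 = \<nu> - 1"
    unfolding D2_def by (simp add: card_image inj_on_def)
  have D1: "D1 \<subseteq> Idx"
  proof
    fix i assume "i \<in> D1"
    then obtain s v t where i: "i = (s, v, e s v t)"
      and m: "s \<in> {1..\<nu>}" "v \<in> {1..g s}" "t \<in> {1..\<tau> s}"
      unfolding D1_def S_def by auto
    then show "i \<in> Idx" using e[OF m] Iq[OF m] by (auto simp: Idx_def)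
  qed
  have D2: "D2 \<subseteq> Idx"
  proof
    fix i assume "i \<in> D2"
    then obtain s where "i = (s, 1, 0)" "s \<in> {2..\<nu>}" unfolding D2_def by auto
    then show "i \<in> Idx" using g2[of s] q0 by (auto simp: Idx_def)
  qed
  have disj: "D1 \<inter> D2 = {}" unfolding D1_def D2_def S_def by auto
  have finJ: "finite J" unfolding J_def using finIdx by blast
  have cJ: "card Idx = card J + card D1 + card D2"
  proof -
    have "card Idx = card J + card (D1 \<union> D2)"
      unfolding J_def using D1 D2 finIdx
      by (subst card_Diff_subset) (auto intro: finite_subset card_mono simp: card_mono)
    also have "card (D1 \<union> D2) = card D1 + card D2"
      using disj D1 D2 finIdx by (intro card_Un_disjoint) (auto intro: finite_subset)
    finally show ?thesis by simp
  qed
  have "int (card Idx) = (\<Sum>s=1..\<nu>. int (g s)) * int q"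
    unfolding Idx_Sigma by (simp add: sum_distrib_right)
  moreover have "int (card D1) = (\<Sum>s=1..\<nu>. (int (g s) - 1) * int (\<tau> s))"
    unfolding cardD1 of_nat_sum using g2 by (intro sum.cong) (force simp: of_nat_diff)+
  moreover have "int (card D2) = int \<nu> - 1"
    unfolding cardD2 using hyps(3) by simp
  ultimately have bound: "int (card J) \<le> (\<Sum>s=1..\<nu>. int (g s)) * int q
            - (\<Sum>s=1..\<nu>. (int (g s) - 1) * int (\<tau> s)) - (int \<nu> - 1)"
    using cJ by linarith
  have "J \<subset> Idx"
  proof -
    have "(1, 2, 1) \<in> S" using hyps(3) g2[of 1] \<tau>1[of 1] by (simp add: S_def)
    then have "D1 \<noteq> {}" unfolding D1_def by blast
    then show ?thesis unfolding J_def using D1 by blast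
  qed

  let ?F = "\<lambda>(s, v, j). P s v j"
  have memJ: "lin_comb ?F J (P s v j)" if "(s, v, j) \<in> J" for s v j
    using lin_comb_member[OF finJ that, of ?F] by simp
  have sum_first: "(\<lambda>x. \<Sum>j\<in>{0..<q}. P s 1 j x) = (\<lambda>x. x)" if "s \<in> {1..\<nu>}" for s
    using res[of s 1] g2[OF that] that unfolding resolution_of_identity_def by auto
  have "(1, 1, j) \<in> J" if "j \<in> {0..<q}" for j
    using that hyps(3) g2[of 1] by (auto simp: J_def Idx_def D1_def D2_def S_def)
  then have "lin_comb ?F J (\<lambda>x. \<Sum>j\<in>{0..<q}. P 1 1 j x)"
    by (intro lin_comb_sum memJ)
  then have lin_id: "lin_comb ?F J (\<lambda>x. x)"
    using sum_first[of 1] hyps(3) by simp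
  have first: "lin_comb ?F J (P s 1 j)" if s: "s \<in> {1..\<nu>}" and j: "j \<in> {0..<q}" for s j
  proof (cases "j = 0")
    case False
    then show ?thesis
      using that g2[OF s] by (intro memJ) (auto simp: J_def Idx_def D1_def D2_def S_def)
  next
    case True
    show ?thesis unfolding True
    proof (rule lin_comb_sum_remove[where K = "{0..<q}"])
      show "lin_comb ?F J (\<lambda>x. \<Sum>i\<in>{0..<q}. P s 1 i x)"
        using sum_first[OF s] lin_id by simp
      show "lin_comb ?F J (P s 1 i)" if "i \<in> {0..<q} - {0}" for i
        using that s g2[OF s] by (intro memJ) (auto simp: J_def Idx_def D1_def D2_def S_def)
    qed (use q0 in auto)
  qed
  have block: "lin_comb ?F J (Q s t)" if "s \<in> {1..\<nu>}" "t \<in> {1..\<tau> s}" for s t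
  proof -
    have v: "1 \<in> {1..g s}" using g2[OF that(1)] by simp
    have "lin_comb ?F J (\<lambda>x. \<Sum>j\<in>I s 1 t. P s 1 j x)"
      using Iq[OF that(1) v that(2)] that(1) by (intro lin_comb_sum first) auto
    moreover have "(\<lambda>x. \<Sum>j\<in>I s 1 t. P s 1 j x) = Q s t"
      using I[OF that(1) v] that(2) by auto
    ultimately show ?thesis by simp
  qed
  have all: "lin_comb ?F J (P s v j)"
    if s: "s \<in> {1..\<nu>}" and v: "v \<in> {1..g s}" and j: "j \<in> {0..<q}" for s v j
  proof (cases "v = 1 \<or> (s, v, j) \<in> J")
    case True
    then show ?thesis using first[OF s j] memJ by auto
  next
    case False
    then have "(s, v, j) \<in> D1"
      using that by (auto simp: J_def Idx_def D2_def)
    then obtain t where t: "t \<in> {1..\<tau> s}" and jt: "j = e s v t" and v2: "v \<ge> 2"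
      unfolding D1_def S_def by auto
    show ?thesis
    proof (rule lin_comb_sum_remove[where K = "I s v t"])
      show "finite (I s v t)" using Iq[OF s v t] finite_subset by blast
      show "j \<in> I s v t" using e[OF s v t] jt by simp
      have "(\<lambda>x. \<Sum>i\<in>I s v t. P s v i x) = Q s t" using I[OF s v] t by auto
      then show "lin_comb ?F J (\<lambda>x. \<Sum>i\<in>I s v t. P s v i x)" using block[OF s t] by simp
      fix i assume i: "i \<in> I s v t - {j}"
      have ne: "i \<noteq> e s v t'" if "t' \<in> {1..\<tau> s}" for t'
        using i jt e[OF s v that] same_block[OF s v t that, of i] by auto
      have "(s, v, i) \<notin> D1"
        unfolding D1_def S_def using ne by force
      then show "lin_comb ?F J (P s v i)"
        using i Iq[OF s v t] s v v2
        by (intro memJ) (auto simp: J_def Idx_def D2_def)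
    qed
  qed
  have "replaceable_by ?F Idx J"
    unfolding replaceable_by_def
  proof (intro conjI ballI)
    show "J \<subseteq> Idx" using \<open>J \<subset> Idx\<close> by blast
    fix i assume "i \<in> Idx"
    then obtain s v j where i: "i = (s, v, j)"
      and "s \<in> {1..\<nu>}" "v \<in> {1..g s}" "j \<in> {0..<q}"
      unfolding Idx_def by auto
    then have "lin_comb ?F J (P s v j)" using all by blast
    then show "\<exists>c. \<forall>x. ?F i x = (\<Sum>j\<in>J. scale (c j) (?F j x))"
      unfolding lin_comb_def i by simp
  qed (fact finJ)
  with \<open>J \<subset> Idx\<close> bound show ?thesis by blast
qed

end
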